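(* Every cartesian category is coherent. That is: if $\mathcal A$ is a cartesian category, $F$ and $G$ are shapes of arities $m$ and $n$, and $\alpha,\beta:F\to G$ are two canonical transformations in $\mathcal A$ (regarded as a cartesian category) with the same graph $\Gamma:\{1,\dots,n\}\to\{1,\dots,m\}$, then $\alpha=\beta$ as indexed families, i.e. $\alpha(A_1,\dots,A_m)=\beta(A_1,\dots,A_m)$ for all objects $A_1,\dots,A_m$ of $\mathcal A$.
   Context: **Cartesian categories.** Composition of $f:A\to B$ and $g:B\to C$ is written $gf$. A category with multiplication is a category $\mathcal A$ with a bifunctor $\cdot:\mathcal A\times\mathcal A\to\mathcal A$ and a special object $\mathrm I$. It is *monoidal* if for all objects $A,B,C$ it has special arrows $\sigma_A:\mathrm I\cdot A\to A$, $\sigma^i_A:A\to \mathrm I\cdot A$, $\delta_A:A\cdot \mathrm I\to A$, $\delta^i_A:A\to A\cdot \mathrm I$, $\overrightarrow{b}_{A,B,C}:A\cdot(B\cdot C)\to(A\cdot B)\cdot C$, $\overleftarrow{b}_{A,B,C}:(A\cdot B)\cdot C\to A\cdot(B\cdot C)$ satisfying: $f\sigma_A=\sigma_B(1_{\mathrm I}\cdot f)$ and $f\delta_A=\delta_B(f\cdot 1_{\mathrm I})$ for $f:A\to B$; $\sigma_A\sigma^i_A=1_A$, $\sigma^i_A\sigma_A=1_{\mathrm I\cdot A}$, $\delta_A\delta^i_A=1_A$, $\delta^i_A\delta_A=1_{A\cdot \mathrm I}$; $\sigma_{\mathrm I}=\delta_{\mathrm I}$; $((f\cdot g)\cdot h)\overrightarrow{b}_{A,B,C}=\overrightarrow{b}_{D,E,F}(f\cdot(g\cdot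 h))$ for $f:A\to D$, $g:B\to E$, $h:C\to F$; $\overrightarrow{b}_{A,B,C}\overleftarrow{b}_{A,B,C}=1$, $\overleftarrow{b}_{A,B,C}\overrightarrow{b}_{A,B,C}=1$; $(\delta_A\cdot 1_B)\overrightarrow{b}_{A,\mathrm I,B}=1_A\cdot\sigma_B$; $\overrightarrow{b}_{A\cdot B,C,D}\overrightarrow{b}_{A,B,C\cdot D}=(\overrightarrow{b}_{A,B,C}\cdot 1_D)\overrightarrow{b}_{A,B\cdot C,D}(1_A\cdot\overrightarrow{b}_{B,C,D})$. It is *symmetric monoidal* if moreover it has special arrows $c_{A,B}:A\cdot B\to B\cdot A$ with: $(g\cdot f)c_{A,B}=c_{C,D}(f\cdot g)$ for $f:A\to C$, $g:B\to D$; $c_{B,A}c_{A,B}=1_{A\cdot B}$; $\sigma_Ac_{A,\mathrm I}=\delta_A$; $\overrightarrow{b}_{C,A,B}c_{A\cdot B,C}\overrightarrow{b}_{A,B,C}=(c_{A,C}\cdot 1_B)\overrightarrow{b}_{A,C,B}(1_A\cdot c_{B,C})$. A symmetric monoidal category is *relevant* if it has special arrows $w_A:A\to A\cdot A$ with: $(f\cdot f)w_A=w_Bf$ for $f:A\to B$; $\sigma_{\mathrm I}w_{\mathrm I}=1_{\mathrm I}$; $\overrightarrow{b}_{A,A,A}(1_A\cdot w_A)w_A=(w_A\cdot 1_A)w_A$; $c_{A,A}w_A=w_A$; $c^m_{A,B,A,B}w_{A\cdot B}=w_A\cdot w_B$, where $c^m_{A,B,C,D}=\overrightarrow{b}_{A,C,B\cdot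 D}(1_A\cdot(\overleftarrow{b}_{C,B,D}(c_{B,C}\cdot 1_D)\overrightarrow{b}_{B,C,D}))\overleftarrow{b}_{A,B,C\cdot D}$. A symmetric monoidal category is *affine* if it has special arrows $k_A:A\to\mathrm I$ with: $k_A=k_Bf$ for $f:A\to B$; $k_{\mathrm I}=1_{\mathrm I}$. A category that is both relevant and affine (with the same symmetric monoidal structure) is *cartesian* if moreover $\sigma_A(k_A\cdot 1_A)w_A=1_A$ and $\delta_A(1_A\cdot k_A)w_A=1_A$ for every $A$. **Shapes.** Shapes are terms built from the symbols $\Box$ and $\mathrm I$ by the binary operation $\cdot$. A shape with $m$ occurrences of $\Box$ (arity $m\ge 0$) defines a functor $\mathcal A^m\to\mathcal A$ by putting the arguments, in order, in place of the boxes ($\Box$ gives the identity functor, $\mathrm I$ the constant $\mathrm I$, and $(F\cdot G)(A_1,\dots,A_{m+n})=F(A_1,\dots,A_m)\cdot G(A_{m+1},\dots,A_{m+n})$). A shape and its functor are denoted by the same letter. **Canonical transformations.** For shapes $F,G$ of arities $m,n$, a canonical transformation $\alpha:F\to G$ with graph $\Gamma:\{1,\dots,n\}\to\{1,\dots,m\}$ is a family of arrows $\alpha(A_1,\dots,A_m):F(A_1,\dots,A_m)\to G(A_{\Gamma(1)},\dots,A_{\Gamma(n)})$, indexed by $(A_1,\dots,A_m)\in\mathcal A^m$, obtained inductively as follows ($F,G,H$ have arities $m,n,l$). (i) Primitive ones (components are the corresponding special arrows indexed by values of the functors): $1_F:F\to F$, $\sigma_F:\mathrm I\cdot F\to F$,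 $\sigma^i_F:F\to\mathrm I\cdot F$, $\delta_F:F\cdot\mathrm I\to F$, $\delta^i_F:F\to F\cdot\mathrm I$, $\overrightarrow{b}_{F,G,H}:F\cdot(G\cdot H)\to(F\cdot G)\cdot H$, $\overleftarrow{b}_{F,G,H}:(F\cdot G)\cdot H\to F\cdot(G\cdot H)$, all with identity functions as graphs; $c_{F,G}:F\cdot G\to G\cdot F$ with graph $\Gamma(i)=m+i$ for $1\le i\le n$, $\Gamma(n+j)=j$ for $1\le j\le m$; $w_F:F\to F\cdot F$ with graph $\Gamma(i)=\Gamma(m+i)=i$ for $1\le i\le m$; $k_F:F\to\mathrm I$ with the empty function $\emptyset\to\{1,\dots,m\}$ as graph. (ii) If $\alpha:F_1\to G_1$ has graph $\Phi$, $\beta:F_2\to G_2$ has graph $\Psi$, and $F_1,F_2,G_1,G_2$ have arities $m,n,k,l$, then $\alpha\cdot\beta:F_1\cdot F_2\to G_1\cdot G_2$, with components $\alpha(A_1,\dots,A_m)\cdot\beta(A_{m+1},\dots,A_{m+n})$, is canonical with graph $\Gamma(i)=\Phi(i)$ for $1\le i\le k$, $\Gamma(k+j)=m+\Psi(j)$ for $1\le j\le l$. (iii) If $\alpha:F\to G$ has graph $\Phi:\{1,\dots,n\}\to\{1,\dots,m\}$ and $\beta:G\to H$ has graph $\Psi:\{1,\dots,l\}\to\{1,\dots,n\}$, then $\beta\alpha:F\to H$, with components $\beta(A_{\Phi(1)},\dots,A_{\Phi(n)})\,\alpha(A_1,\dots,A_m)$, is canonical with graph $i\mapsto\Phi(\Psi(i))$.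 *)

theory Defs
  imports Main
begin

section \<open>Cartesian categories\<close>

text \<open>
  Objects and arrows form carrier sets of a type of objects and a type of arrows. Composition
  is written in applicative order: \<open>g \<cdot> f\<close> is the composite of \<open>f : A \<rightarrow> B\<close> and \<open>g : B \<rightarrow> C\<close>.
  Outside the carriers, and on non-composable pairs, the operations are unconstrained.
\<close>

record ('o, 'a) category =
  Obj :: "'o set"
  Arr :: "'a set"
  Src :: "'a \<Rightarrow> 'o"
  Trg :: "'a \<Rightarrow> 'o"
  ide :: "'o \<Rightarrow> 'a" ("\<one>\<index>")
  cmp :: "'a \<Rightarrow> 'a \<Rightarrow> 'a" (infixl "\<cdot>\<index>" 70)

definition hom :: "('o, 'a, 'z) category_scheme \<Rightarrow> 'o \<Rightarrow> 'o \<Rightarrow> 'a set" where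
  "hom \<A> A B = {f \<in> Arr \<A>. Src \<A> f = A \<and> Trg \<A> f = B}"

locale category =
  fixes \<A> :: "('o, 'a, 'z) category_scheme" (structure)
  assumes Src_Obj: "f \<in> Arr \<A> \<Longrightarrow> Src \<A> f \<in> Obj \<A>"
    and Trg_Obj: "f \<in> Arr \<A> \<Longrightarrow> Trg \<A> f \<in> Obj \<A>"
    and ide_hom: "A \<in> Obj \<A> \<Longrightarrow> \<one> A \<in> hom \<A> A A"
    and cmp_hom: "f \<in> hom \<A> A B \<Longrightarrow> g \<in> hom \<A> B C \<Longrightarrow> g \<cdot> f \<in> hom \<A> A C"
    and cmp_ide_right: "f \<in> hom \<A> A B \<Longrightarrow> f \<cdot> \<one> A = f"
    and cmp_ide_left: "f \<in> hom \<A> A B \<Longrightarrow> \<one> B \<cdot> f = f"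
    and cmp_assoc: "f \<in> hom \<A> A B \<Longrightarrow> g \<in> hom \<A> B C \<Longrightarrow> h \<in> hom \<A> C D
      \<Longrightarrow> h \<cdot> (g \<cdot> f) = (h \<cdot> g) \<cdot> f"

record ('o, 'a) mult_category = "('o, 'a) category" +
  mult_obj :: "'o \<Rightarrow> 'o \<Rightarrow> 'o" (infixr "\<odot>\<index>" 80)
  mult_arr :: "'a \<Rightarrow> 'a \<Rightarrow> 'a" (infixr "\<otimes>\<index>" 80)
  unit_obj :: "'o" ("\<I>\<index>")

locale mult_category = category \<A>
  for \<A> :: "('o, 'a, 'z) mult_category_scheme" (structure) +
  assumes unit_Obj: "\<I> \<in> Obj \<A>"
    and mult_Obj: "A \<in> Obj \<A> \<Longrightarrow> B \<in> Obj \<A> \<Longrightarrow> A \<odot> B \<in> Obj \<A>"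
    and mult_hom: "f \<in> hom \<A> A B \<Longrightarrow> g \<in> hom \<A> C D \<Longrightarrow> f \<otimes> g \<in> hom \<A> (A \<odot> C) (B \<odot> D)"
    and mult_ide: "A \<in> Obj \<A> \<Longrightarrow> B \<in> Obj \<A> \<Longrightarrow> \<one> A \<otimes> \<one> B = \<one> (A \<odot> B)"
    and mult_cmp: "f \<in> hom \<A> A B \<Longrightarrow> g \<in> hom \<A> B C \<Longrightarrow> f' \<in> hom \<A> A' B' \<Longrightarrow> g' \<in> hom \<A> B' C'
      \<Longrightarrow> (g \<cdot> f) \<otimes> (g' \<cdot> f') = (g \<otimes> g') \<cdot> (f \<otimes> f')"

record ('o, 'a) monoidal_category = "('o, 'a) mult_category" +
  sigma :: "'o \<Rightarrow> 'a" ("\<^bold>\<sigma>\<index>")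
  sigma_inv :: "'o \<Rightarrow> 'a" ("\<^bold>\<sigma>i\<index>")
  delta :: "'o \<Rightarrow> 'a" ("\<^bold>\<delta>\<index>")
  delta_inv :: "'o \<Rightarrow> 'a" ("\<^bold>\<delta>i\<index>")
  assoc_right :: "'o \<Rightarrow> 'o \<Rightarrow> 'o \<Rightarrow> 'a" ("\<^bold>b\<^sup>\<rightarrow>\<index>")
  assoc_left :: "'o \<Rightarrow> 'o \<Rightarrow> 'o \<Rightarrow> 'a" ("\<^bold>b\<^sup>\<leftarrow>\<index>")

locale monoidal_category = mult_category \<A>
  for \<A> :: "('o, 'a, 'z) monoidal_category_scheme" (structure) +
  assumes sigma_hom: "A \<in> Obj \<A> \<Longrightarrow> \<^bold>\<sigma> A \<in> hom \<A> (\<I> \<odot> A) A"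
    and sigma_inv_hom: "A \<in> Obj \<A> \<Longrightarrow> \<^bold>\<sigma>i A \<in> hom \<A> A (\<I> \<odot> A)"
    and delta_hom: "A \<in> Obj \<A> \<Longrightarrow> \<^bold>\<delta> A \<in> hom \<A> (A \<odot> \<I>) A"
    and delta_inv_hom: "A \<in> Obj \<A> \<Longrightarrow> \<^bold>\<delta>i A \<in> hom \<A> A (A \<odot> \<I>)"
    and assoc_right_hom: "A \<in> Obj \<A> \<Longrightarrow> B \<in> Obj \<A> \<Longrightarrow> C \<in> Obj \<A>
      \<Longrightarrow> \<^bold>b\<^sup>\<rightarrow> A B C \<in> hom \<A> (A \<odot> (B \<odot> C)) ((A \<odot> B) \<odot> C)"
    and assoc_left_hom: "A \<in> Obj \<A> \<Longrightarrow> B \<in> Obj \<A> \<Longrightarrow> C \<in> Obj \<A>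
      \<Longrightarrow> \<^bold>b\<^sup>\<leftarrow> A B C \<in> hom \<A> ((A \<odot> B) \<odot> C) (A \<odot> (B \<odot> C))"
    and sigma_nat: "f \<in> hom \<A> A B \<Longrightarrow> f \<cdot> \<^bold>\<sigma> A = \<^bold>\<sigma> B \<cdot> (\<one> \<I> \<otimes> f)"
    and delta_nat: "f \<in> hom \<A> A B \<Longrightarrow> f \<cdot> \<^bold>\<delta> A = \<^bold>\<delta> B \<cdot> (f \<otimes> \<one> \<I>)"
    and sigma_sigma_inv: "A \<in> Obj \<A> \<Longrightarrow> \<^bold>\<sigma> A \<cdot> \<^bold>\<sigma>i A = \<one> A"
    and sigma_inv_sigma: "A \<in> Obj \<A> \<Longrightarrow> \<^bold>\<sigma>i A \<cdot> \<^bold>\<sigma> A = \<one> (\<I> \<odot> A)"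
    and delta_delta_inv: "A \<in> Obj \<A> \<Longrightarrow> \<^bold>\<delta> A \<cdot> \<^bold>\<delta>i A = \<one> A"
    and delta_inv_delta: "A \<in> Obj \<A> \<Longrightarrow> \<^bold>\<delta>i A \<cdot> \<^bold>\<delta> A = \<one> (A \<odot> \<I>)"
    and sigma_unit: "\<^bold>\<sigma> \<I> = \<^bold>\<delta> \<I>"
    and assoc_nat: "f \<in> hom \<A> A D \<Longrightarrow> g \<in> hom \<A> B E \<Longrightarrow> h \<in> hom \<A> C F
      \<Longrightarrow> ((f \<otimes> g) \<otimes> h) \<cdot> \<^bold>b\<^sup>\<rightarrow> A B C = \<^bold>b\<^sup>\<rightarrow> D E F \<cdot> (f \<otimes> (g \<otimes> h))"
    and assoc_right_left: "A \<in> Obj \<A> \<Longrightarrow> B \<in> Obj \<A> \<Longrightarrow> C \<in> Obj \<A>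
      \<Longrightarrow> \<^bold>b\<^sup>\<rightarrow> A B C \<cdot> \<^bold>b\<^sup>\<leftarrow> A B C = \<one> ((A \<odot> B) \<odot> C)"
    and assoc_left_right: "A \<in> Obj \<A> \<Longrightarrow> B \<in> Obj \<A> \<Longrightarrow> C \<in> Obj \<A>
      \<Longrightarrow> \<^bold>b\<^sup>\<leftarrow> A B C \<cdot> \<^bold>b\<^sup>\<rightarrow> A B C = \<one> (A \<odot> (B \<odot> C))"
    and triangle: "A \<in> Obj \<A> \<Longrightarrow> B \<in> Obj \<A>
      \<Longrightarrow> (\<^bold>\<delta> A \<otimes> \<one> B) \<cdot> \<^bold>b\<^sup>\<rightarrow> A \<I> B = \<one> A \<otimes> \<^bold>\<sigma> B"
    and pentagon: "A \<in> Obj \<A> \<Longrightarrow> B \<in> Obj \<A> \<Longrightarrow> C \<in> Obj \<A> \<Longrightarrow> D \<in> Obj \<A>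
      \<Longrightarrow> \<^bold>b\<^sup>\<rightarrow> (A \<odot> B) C D \<cdot> \<^bold>b\<^sup>\<rightarrow> A B (C \<odot> D)
        = (\<^bold>b\<^sup>\<rightarrow> A B C \<otimes> \<one> D) \<cdot> \<^bold>b\<^sup>\<rightarrow> A (B \<odot> C) D \<cdot> (\<one> A \<otimes> \<^bold>b\<^sup>\<rightarrow> B C D)"

record ('o, 'a) symmetric_monoidal_category = "('o, 'a) monoidal_category" +
  symm :: "'o \<Rightarrow> 'o \<Rightarrow> 'a" ("\<^bold>c\<index>")

locale symmetric_monoidal_category = monoidal_category \<A>
  for \<A> :: "('o, 'a, 'z) symmetric_monoidal_category_scheme" (structure) +
  assumes symm_hom: "A \<in> Obj \<A> \<Longrightarrow> B \<in> Obj \<A> \<Longrightarrow> \<^bold>c A B \<in> hom \<A> (A \<odot> B) (B \<odot> A)"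
    and symm_nat: "f \<in> hom \<A> A C \<Longrightarrow> g \<in> hom \<A> B D \<Longrightarrow> (g \<otimes> f) \<cdot> \<^bold>c A B = \<^bold>c C D \<cdot> (f \<otimes> g)"
    and symm_symm: "A \<in> Obj \<A> \<Longrightarrow> B \<in> Obj \<A> \<Longrightarrow> \<^bold>c B A \<cdot> \<^bold>c A B = \<one> (A \<odot> B)"
    and sigma_symm: "A \<in> Obj \<A> \<Longrightarrow> \<^bold>\<sigma> A \<cdot> \<^bold>c A \<I> = \<^bold>\<delta> A"
    and hexagon: "A \<in> Obj \<A> \<Longrightarrow> B \<in> Obj \<A> \<Longrightarrow> C \<in> Obj \<A>
      \<Longrightarrow> \<^bold>b\<^sup>\<rightarrow> C A B \<cdot> \<^bold>c (A \<odot> B) C \<cdot> \<^bold>b\<^sup>\<rightarrow> A B C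
        = (\<^bold>c A C \<otimes> \<one> B) \<cdot> \<^bold>b\<^sup>\<rightarrow> A C B \<cdot> (\<one> A \<otimes> \<^bold>c B C)"

definition middle_symm ::
    "('o, 'a, 'z) symmetric_monoidal_category_scheme \<Rightarrow> 'o \<Rightarrow> 'o \<Rightarrow> 'o \<Rightarrow> 'o \<Rightarrow> 'a" ("\<^bold>c\<^sup>m\<index>") where
  "\<^bold>c\<^sup>m\<^bsub>\<A>\<^esub> A B C D =
    \<^bold>b\<^sup>\<rightarrow>\<^bsub>\<A>\<^esub> A C (B \<odot>\<^bsub>\<A>\<^esub> D)
    \<cdot>\<^bsub>\<A>\<^esub> (\<one>\<^bsub>\<A>\<^esub> A \<otimes>\<^bsub>\<A>\<^esub> (\<^bold>b\<^sup>\<leftarrow>\<^bsub>\<A>\<^esub> C B D \<cdot>\<^bsub>\<A>\<^esub> (\<^bold>c\<^bsub>\<A>\<^esub> B C \<otimes>\<^bsub>\<A>\<^esub> \<one>\<^bsub>\<A>\<^esub> D) \<cdot>\<^bsub>\<A>\<^esub> \<^bold>b\<^sup>\<rightarrow>\<^bsub>\<A>\<^esub> B C D))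
    \<cdot>\<^bsub>\<A>\<^esub> \<^bold>b\<^sup>\<leftarrow>\<^bsub>\<A>\<^esub> A B (C \<odot>\<^bsub>\<A>\<^esub> D)"

text \<open>
  The arrows \<open>w\<close> and \<open>k\<close> are locale parameters rather than record fields, so that a cartesian
  category is a relevant and an affine category over the same symmetric monoidal structure.
\<close>

locale relevant_category = symmetric_monoidal_category \<A>
  for \<A> :: "('o, 'a, 'z) symmetric_monoidal_category_scheme" (structure) +
  fixes w :: "'o \<Rightarrow> 'a"
  assumes w_hom: "A \<in> Obj \<A> \<Longrightarrow> w A \<in> hom \<A> A (A \<odot> A)"
    and w_nat: "f \<in> hom \<A> A B \<Longrightarrow> (f \<otimes> f) \<cdot> w A = w B \<cdot> f"
    and sigma_w_unit: "\<^bold>\<sigma> \<I> \<cdot> w \<I> = \<one> \<I>"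
    and w_assoc: "A \<in> Obj \<A> \<Longrightarrow> \<^bold>b\<^sup>\<rightarrow> A A A \<cdot> (\<one> A \<otimes> w A) \<cdot> w A = (w A \<otimes> \<one> A) \<cdot> w A"
    and symm_w: "A \<in> Obj \<A> \<Longrightarrow> \<^bold>c A A \<cdot> w A = w A"
    and middle_symm_w: "A \<in> Obj \<A> \<Longrightarrow> B \<in> Obj \<A> \<Longrightarrow> \<^bold>c\<^sup>m A B A B \<cdot> w (A \<odot> B) = w A \<otimes> w B"

locale affine_category = symmetric_monoidal_category \<A>
  for \<A> :: "('o, 'a, 'z) symmetric_monoidal_category_scheme" (structure) +
  fixes k :: "'o \<Rightarrow> 'a"
  assumes k_hom: "A \<in> Obj \<A> \<Longrightarrow> k A \<in> hom \<A> A \<I>"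
    and k_nat: "f \<in> hom \<A> A B \<Longrightarrow> k A = k B \<cdot> f"
    and k_unit: "k \<I> = \<one> \<I>"

locale cartesian_category = relevant_category \<A> w + affine_category \<A> k
  for \<A> :: "('o, 'a, 'z) symmetric_monoidal_category_scheme" (structure)
    and w k :: "'o \<Rightarrow> 'a" +
  assumes sigma_k_w: "A \<in> Obj \<A> \<Longrightarrow> \<^bold>\<sigma> A \<cdot> (k A \<otimes> \<one> A) \<cdot> w A = \<one> A"
    and delta_k_w: "A \<in> Obj \<A> \<Longrightarrow> \<^bold>\<delta> A \<cdot> (\<one> A \<otimes> k A) \<cdot> w A = \<one> A"

section \<open>Shapes\<close>

datatype shape = Box | Unit | Mult shape shape (infixr "\<diamondop>" 80)

primrec arity :: "shape \<Rightarrow> nat" where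
  "arity Box = 1"
| "arity Unit = 0"
| "arity (F \<diamondop> G) = arity F + arity G"

text \<open>An object \<open>(A\<^sub>1, \<dots>, A\<^sub>m)\<close> of the \<open>m\<close>-th power of \<open>\<A>\<close> is a list of length \<open>m\<close>.\<close>

definition tuples :: "('o, 'a, 'z) category_scheme \<Rightarrow> nat \<Rightarrow> 'o list set" where
  "tuples \<A> m = {As. length As = m \<and> set As \<subseteq> Obj \<A>}"

primrec shape_obj :: "('o, 'a, 'z) mult_category_scheme \<Rightarrow> shape \<Rightarrow> 'o list \<Rightarrow> 'o" where
  "shape_obj \<A> Box As = hd As"
| "shape_obj \<A> Unit As = \<I>\<^bsub>\<A>\<^esub>"
| "shape_obj \<A> (F \<diamondop> G) As =
    shape_obj \<A> F (take (arity F) As) \<odot>\<^bsub>\<A>\<^esub> shape_obj \<A> G (drop (arity F) As)"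

section \<open>Canonical transformations\<close>

text \<open>
  A graph \<open>\<Gamma> : {1, \<dots>, n} \<rightarrow> {1, \<dots>, m}\<close> is the list of its \<open>n\<close> values, with all indices shifted
  down by one: \<open>\<Gamma> ! i < m\<close> for \<open>i < n\<close>. Hence equality of lists is equality of graphs.
\<close>

definition reindex :: "'o list \<Rightarrow> nat list \<Rightarrow> 'o list" where
  "reindex As \<Gamma> = map (\<lambda>i. As ! i) \<Gamma>"

text \<open>
  \<open>canonical \<A> w k F G \<Gamma> \<alpha>\<close>: the family \<open>\<alpha>\<close> is a canonical transformation from \<open>F\<close> to \<open>G\<close> with
  graph \<open>\<Gamma>\<close>. Only the values of \<open>\<alpha>\<close> on \<^term>\<open>tuples \<A> (arity F)\<close> are meaningful.
\<close>

inductive canonical ::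
  "('o, 'a, 'z) symmetric_monoidal_category_scheme \<Rightarrow> ('o \<Rightarrow> 'a) \<Rightarrow> ('o \<Rightarrow> 'a) \<Rightarrow>
    shape \<Rightarrow> shape \<Rightarrow> nat list \<Rightarrow> ('o list \<Rightarrow> 'a) \<Rightarrow> bool"
  for \<A> w k where
  ide: "canonical \<A> w k F F [0..<arity F] (\<lambda>As. \<one>\<^bsub>\<A>\<^esub> (shape_obj \<A> F As))"
| sigma: "canonical \<A> w k (Unit \<diamondop> F) F [0..<arity F] (\<lambda>As. \<^bold>\<sigma>\<^bsub>\<A>\<^esub> (shape_obj \<A> F As))"
| sigma_inv: "canonical \<A> w k F (Unit \<diamondop> F) [0..<arity F] (\<lambda>As. \<^bold>\<sigma>i\<^bsub>\<A>\<^esub> (shape_obj \<A> F As))"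
| delta: "canonical \<A> w k (F \<diamondop> Unit) F [0..<arity F] (\<lambda>As. \<^bold>\<delta>\<^bsub>\<A>\<^esub> (shape_obj \<A> F As))"
| delta_inv: "canonical \<A> w k F (F \<diamondop> Unit) [0..<arity F] (\<lambda>As. \<^bold>\<delta>i\<^bsub>\<A>\<^esub> (shape_obj \<A> F As))"
| assoc_right: "canonical \<A> w k (F \<diamondop> (G \<diamondop> H)) ((F \<diamondop> G) \<diamondop> H) [0..<arity F + arity G + arity H]
    (\<lambda>As. \<^bold>b\<^sup>\<rightarrow>\<^bsub>\<A>\<^esub> (shape_obj \<A> F (take (arity F) As))
                 (shape_obj \<A> G (take (arity G) (drop (arity F) As)))
                 (shape_obj \<A> H (drop (arity F + arity G) As)))"
| assoc_left: "canonical \<A> w k ((F \<diamondop> G) \<diamondop> H) (F \<diamondop> (G \<diamondop> H)) [0..<arity F + arity G + arity H]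
    (\<lambda>As. \<^bold>b\<^sup>\<leftarrow>\<^bsub>\<A>\<^esub> (shape_obj \<A> F (take (arity F) As))
                 (shape_obj \<A> G (take (arity G) (drop (arity F) As)))
                 (shape_obj \<A> H (drop (arity F + arity G) As)))"
| symm: "canonical \<A> w k (F \<diamondop> G) (G \<diamondop> F) ([arity F..<arity F + arity G] @ [0..<arity F])
    (\<lambda>As. \<^bold>c\<^bsub>\<A>\<^esub> (shape_obj \<A> F (take (arity F) As)) (shape_obj \<A> G (drop (arity F) As)))"
| w: "canonical \<A> w k F (F \<diamondop> F) ([0..<arity F] @ [0..<arity F]) (\<lambda>As. w (shape_obj \<A> F As))"
| k: "canonical \<A> w k F Unit [] (\<lambda>As. k (shape_obj \<A> F As))"
| mult: "canonical \<A> w k F1 G1 \<Phi> \<alpha> \<Longrightarrow> canonical \<A> w k F2 G2 \<Psi> \<beta> \<Longrightarrow>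
    canonical \<A> w k (F1 \<diamondop> F2) (G1 \<diamondop> G2) (\<Phi> @ map (\<lambda>j. arity F1 + j) \<Psi>)
      (\<lambda>As. \<alpha> (take (arity F1) As) \<otimes>\<^bsub>\<A>\<^esub> \<beta> (drop (arity F1) As))"
| cmp: "canonical \<A> w k F G \<Phi> \<alpha> \<Longrightarrow> canonical \<A> w k G H \<Psi> \<beta> \<Longrightarrow>
    canonical \<A> w k F H (map (\<lambda>i. \<Phi> ! i) \<Psi>) (\<lambda>As. \<beta> (reindex As \<Phi>) \<cdot>\<^bsub>\<A>\<^esub> \<alpha> As)"

lemma canonical_graph:
  assumes "canonical \<A> w k F G \<Gamma> \<alpha>"
  shows "length \<Gamma> = arity G" and "set \<Gamma> \<subseteq> {..<arity F}"
  using assms by (induction rule: canonical.induct) (fastforce simp: subset_iff)+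

lemma tuples_take_drop:
  assumes "As \<in> tuples \<A> (m + n)"
  shows "take m As \<in> tuples \<A> m" and "drop m As \<in> tuples \<A> n"
  using assms by (auto simp: tuples_def dest: in_set_takeD in_set_dropD)

lemma reindex_tuples:
  assumes "As \<in> tuples \<A> m" and "set \<Gamma> \<subseteq> {..<m}"
  shows "reindex As \<Gamma> \<in> tuples \<A> (length \<Gamma>)"
  using assms by (fastforce simp: tuples_def reindex_def subset_iff)

lemma (in mult_category) shape_obj_Obj:
  assumes "As \<in> tuples \<A> (arity F)"
  shows "shape_obj \<A> F As \<in> Obj \<A>"
  using assms
proof (induction F arbitrary: As)
  case Box
  then show ?case by (cases As) (auto simp: tuples_def)
next
  case Unit
  then show ?case by (simp add: unit_Obj)
next
  case (Mult F G)
  then show ?case by (auto intro!: mult_Obj dest: tuples_take_drop)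
qed

lemma (in cartesian_category) canonical_hom:
  assumes "canonical \<A> w k F G \<Gamma> \<alpha>" and "As \<in> tuples \<A> (arity F)"
  shows "\<alpha> As \<in> hom \<A> (shape_obj \<A> F As) (shape_obj \<A> G (reindex As \<Gamma>))"
proof -
  have id: "reindex Bs [0..<m] = Bs" if "Bs \<in> tuples \<A> m" for Bs :: "'o list" and m
    using that by (auto simp: reindex_def tuples_def map_nth)
  have app: "reindex Bs (\<Phi> @ \<Psi>) = reindex Bs \<Phi> @ reindex Bs \<Psi>"
    and len: "length (reindex Bs \<Phi>) = length \<Phi>" for Bs :: "'o list" and \<Phi> \<Psi>
    by (simp_all add: reindex_def)
  have take: "reindex (take m Bs) \<Phi> = reindex Bs \<Phi>"
    if "set \<Phi> \<subseteq> {..<m}" for Bs :: "'o list" and m \<Phi>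
    using that by (auto simp: reindex_def)
  have drop: "reindex Bs (map (\<lambda>j. m + j) \<Phi>) = reindex (drop m Bs) \<Phi>"
    if "m \<le> length Bs" for Bs :: "'o list" and m \<Phi>
    using that by (auto simp: reindex_def)
  show ?thesis
    using assms
  proof (induction arbitrary: As rule: canonical.induct)
    case (symm F G)
    have 1: "reindex As [arity F..<arity F + arity G] = drop (arity F) As"
      using symm by (auto simp: reindex_def tuples_def intro!: nth_equalityI)
    have 2: "reindex As [0..<arity F] = take (arity F) As"
      using symm by (auto simp: reindex_def tuples_def intro!: nth_equalityI)
    have 3: "length As = arity F + arity G" using symm by (simp add: tuples_def)
    show ?case
      using symm
      by (auto simp: app 1 2 3 intro!: symm_hom shape_obj_Obj dest: tuples_take_drop)
  next
    case (mult F1 G1 \<Phi> \<alpha> F2 G2 \<Psi> \<beta>)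
    have As: "take (arity F1) As \<in> tuples \<A> (arity F1)" "drop (arity F1) As \<in> tuples \<A> (arity F2)"
      using mult.prems by (auto dest: tuples_take_drop)
    have g: "length \<Phi> = arity G1" "set \<Phi> \<subseteq> {..<arity F1}"
      using canonical_graph[OF mult.hyps(1)] by auto
    have le: "arity F1 \<le> length As" using mult.prems by (simp add: tuples_def)
    show ?case
      using mult_hom[OF mult.IH(1)[OF As(1)] mult.IH(2)[OF As(2)]]
      by (simp add: app drop[OF le] take[OF g(2)] g(1) len)
  next
    case (cmp F G \<Phi> \<alpha> H \<Psi> \<beta>)
    have g: "length \<Phi> = arity G" "set \<Phi> \<subseteq> {..<arity F}"
      using canonical_graph[OF cmp.hyps(1)] by auto
    have g': "set \<Psi> \<subseteq> {..<arity G}" using canonical_graph[OF cmp.hyps(2)] by auto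
    have t: "reindex As \<Phi> \<in> tuples \<A> (arity G)"
      using reindex_tuples[OF cmp.prems g(2)] g(1) by simp
    have "reindex (reindex As \<Phi>) \<Psi> = reindex As (map (\<lambda>i. \<Phi> ! i) \<Psi>)"
      using g g' by (auto simp: reindex_def)
    then show ?case using cmp_hom[OF cmp.IH(1)[OF cmp.prems] cmp.IH(2)[OF t]] by simp
  next
    case (assoc_right F G H)
    then have t: "As \<in> tuples \<A> (arity F + arity G + arity H)" by (simp add: add.assoc)
    have 1: "take (arity F) As \<in> tuples \<A> (arity F)"
      "take (arity G) (drop (arity F) As) \<in> tuples \<A> (arity G)"
      "drop (arity F + arity G) As \<in> tuples \<A> (arity H)"
      using t by (auto simp: tuples_def dest!: in_set_takeD in_set_dropD)
    show ?case
      using assoc_right_hom[OF 1[THEN shape_obj_Obj]]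
      by (simp add: id[OF t] drop_take add.commute[of "arity G" "arity F"])
  next
    case (assoc_left F G H)
    then have t: "As \<in> tuples \<A> (arity F + arity G + arity H)" by simp
    have 1: "take (arity F) As \<in> tuples \<A> (arity F)"
      "take (arity G) (drop (arity F) As) \<in> tuples \<A> (arity G)"
      "drop (arity F + arity G) As \<in> tuples \<A> (arity H)"
      using t by (auto simp: tuples_def dest!: in_set_takeD in_set_dropD)
    show ?case
      using assoc_left_hom[OF 1[THEN shape_obj_Obj]]
      by (simp add: id[OF t] drop_take add.commute[of "arity G" "arity F"])
  next
    case (w F)
    then show ?case by (auto simp: app id tuples_def[of _ "arity F"] intro!: w_hom shape_obj_Obj)
  qed (auto simp: id tuples_def intro!: shape_obj_Obj ide_hom sigma_hom sigma_inv_hom delta_hom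
      delta_inv_hom k_hom)
qed

end

theory Submission imports Defs
begin

text \<open>
  The arrows \<open>\<delta> (1 \<cdot> k)\<close> and \<open>\<sigma> (k \<cdot> 1)\<close> are the projections of a binary product \<open>A \<cdot> B\<close>, so an
  arrow into the value of a shape is determined by its composites with the projections to the
  boxes of that shape. For a canonical transformation \<open>F \<rightarrow> G\<close> with graph \<open>\<Gamma>\<close>, the composite with
  the \<open>i\<close>-th projection of \<open>G\<close> is the \<open>\<Gamma>(i)\<close>-th projection of \<open>F\<close>, which depends on \<open>\<Gamma>\<close> only.
\<close>

section \<open>Typing of arrows and composites\<close>

lemma hom_iff: "f \<in> hom \<A> A B \<longleftrightarrow> f \<in> Arr \<A> \<and> Src \<A> f = A \<and> Trg \<A> f = B"
  by (simp add: hom_def)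

text \<open>The rules for \<open>hom\<close> leave the middle object of a composite to be guessed.
  With sources and targets computed by equations, typing side conditions can be discharged by
  rewriting alone.\<close>

lemma (in category) Src_Trg [simp]:
  "f \<in> Arr \<A> \<Longrightarrow> Src \<A> f \<in> Obj \<A>" "f \<in> Arr \<A> \<Longrightarrow> Trg \<A> f \<in> Obj \<A>"
  "A \<in> Obj \<A> \<Longrightarrow> \<one> A \<in> Arr \<A>" "A \<in> Obj \<A> \<Longrightarrow> Src \<A> (\<one> A) = A" "A \<in> Obj \<A> \<Longrightarrow> Trg \<A> (\<one> A) = A"
  "f \<in> Arr \<A> \<Longrightarrow> g \<in> Arr \<A> \<Longrightarrow> Src \<A> g = Trg \<A> f \<Longrightarrow> g \<cdot> f \<in> Arr \<A>"
  "f \<in> Arr \<A> \<Longrightarrow> g \<in> Arr \<A> \<Longrightarrow> Src \<A> g = Trg \<A> f \<Longrightarrow> Src \<A> (g \<cdot> f) = Src \<A> f"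
  "f \<in> Arr \<A> \<Longrightarrow> g \<in> Arr \<A> \<Longrightarrow> Src \<A> g = Trg \<A> f \<Longrightarrow> Trg \<A> (g \<cdot> f) = Trg \<A> g"
  using Src_Obj Trg_Obj ide_hom cmp_hom by (auto simp: hom_iff)

lemma (in category) hom_Obj:
  "f \<in> hom \<A> A B \<Longrightarrow> A \<in> Obj \<A>" "f \<in> hom \<A> A B \<Longrightarrow> B \<in> Obj \<A>"
  by (auto simp: hom_iff)

lemma (in category) cmp_ide [simp]:
  "f \<in> Arr \<A> \<Longrightarrow> Src \<A> f = A \<Longrightarrow> f \<cdot> \<one> A = f" "f \<in> Arr \<A> \<Longrightarrow> Trg \<A> f = A \<Longrightarrow> \<one> A \<cdot> f = f"
  using cmp_ide_right cmp_ide_left by (auto simp: hom_iff)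

text \<open>Oriented so that composites are bracketed to the right; the reversed equation brings a
  factor next to its left neighbour where a law has to be applied.\<close>

lemma (in category) cmp_assoc_Arr:
  "f \<in> Arr \<A> \<Longrightarrow> g \<in> Arr \<A> \<Longrightarrow> h \<in> Arr \<A> \<Longrightarrow> Src \<A> g = Trg \<A> f \<Longrightarrow> Src \<A> h = Trg \<A> g
    \<Longrightarrow> (h \<cdot> g) \<cdot> f = h \<cdot> (g \<cdot> f)"
  using cmp_assoc[of f _ _ g _ h] by (auto simp: hom_iff)

lemma (in mult_category) Src_Trg_mult [simp]:
  "\<I> \<in> Obj \<A>" "A \<in> Obj \<A> \<Longrightarrow> B \<in> Obj \<A> \<Longrightarrow> A \<odot> B \<in> Obj \<A>"
  "f \<in> Arr \<A> \<Longrightarrow> g \<in> Arr \<A> \<Longrightarrow> f \<otimes> g \<in> Arr \<A>"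
  "f \<in> Arr \<A> \<Longrightarrow> g \<in> Arr \<A> \<Longrightarrow> Src \<A> (f \<otimes> g) = Src \<A> f \<odot> Src \<A> g"
  "f \<in> Arr \<A> \<Longrightarrow> g \<in> Arr \<A> \<Longrightarrow> Trg \<A> (f \<otimes> g) = Trg \<A> f \<odot> Trg \<A> g"
  "A \<in> Obj \<A> \<Longrightarrow> B \<in> Obj \<A> \<Longrightarrow> \<one> A \<otimes> \<one> B = \<one> (A \<odot> B)"
  using unit_Obj mult_Obj mult_hom mult_ide by (auto simp: hom_iff)

text \<open>The axiom \<open>mult_cmp\<close> reversed, so that composites of products merge into
  one product whose factors can be simplified separately.\<close>

lemma (in mult_category) mult_cmp_Arr:
  "f \<in> Arr \<A> \<Longrightarrow> g \<in> Arr \<A> \<Longrightarrow> f' \<in> Arr \<A> \<Longrightarrow> g' \<in> Arr \<A> \<Longrightarrow> Src \<A> g = Trg \<A> f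
    \<Longrightarrow> Src \<A> g' = Trg \<A> f' \<Longrightarrow> (g \<otimes> g') \<cdot> (f \<otimes> f') = (g \<cdot> f) \<otimes> (g' \<cdot> f')"
  using mult_cmp[of f _ _ g _ f' _ _ g'] by (auto simp: hom_iff)

lemma (in monoidal_category) Src_Trg_monoidal [simp]:
  "A \<in> Obj \<A> \<Longrightarrow> \<^bold>\<sigma> A \<in> Arr \<A>" "A \<in> Obj \<A> \<Longrightarrow> Src \<A> (\<^bold>\<sigma> A) = \<I> \<odot> A" "A \<in> Obj \<A> \<Longrightarrow> Trg \<A> (\<^bold>\<sigma> A) = A"
  "A \<in> Obj \<A> \<Longrightarrow> \<^bold>\<sigma>i A \<in> Arr \<A>" "A \<in> Obj \<A> \<Longrightarrow> Src \<A> (\<^bold>\<sigma>i A) = A" "A \<in> Obj \<A> \<Longrightarrow> Trg \<A> (\<^bold>\<sigma>i A) = \<I> \<odot> A"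
  "A \<in> Obj \<A> \<Longrightarrow> \<^bold>\<delta> A \<in> Arr \<A>" "A \<in> Obj \<A> \<Longrightarrow> Src \<A> (\<^bold>\<delta> A) = A \<odot> \<I>" "A \<in> Obj \<A> \<Longrightarrow> Trg \<A> (\<^bold>\<delta> A) = A"
  "A \<in> Obj \<A> \<Longrightarrow> \<^bold>\<delta>i A \<in> Arr \<A>" "A \<in> Obj \<A> \<Longrightarrow> Src \<A> (\<^bold>\<delta>i A) = A" "A \<in> Obj \<A> \<Longrightarrow> Trg \<A> (\<^bold>\<delta>i A) = A \<odot> \<I>"
  "A \<in> Obj \<A> \<Longrightarrow> B \<in> Obj \<A> \<Longrightarrow> C \<in> Obj \<A> \<Longrightarrow> \<^bold>b\<^sup>\<rightarrow> A B C \<in> Arr \<A>"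
  "A \<in> Obj \<A> \<Longrightarrow> B \<in> Obj \<A> \<Longrightarrow> C \<in> Obj \<A> \<Longrightarrow> Src \<A> (\<^bold>b\<^sup>\<rightarrow> A B C) = A \<odot> (B \<odot> C)"
  "A \<in> Obj \<A> \<Longrightarrow> B \<in> Obj \<A> \<Longrightarrow> C \<in> Obj \<A> \<Longrightarrow> Trg \<A> (\<^bold>b\<^sup>\<rightarrow> A B C) = (A \<odot> B) \<odot> C"
  "A \<in> Obj \<A> \<Longrightarrow> B \<in> Obj \<A> \<Longrightarrow> C \<in> Obj \<A> \<Longrightarrow> \<^bold>b\<^sup>\<leftarrow> A B C \<in> Arr \<A>"
  "A \<in> Obj \<A> \<Longrightarrow> B \<in> Obj \<A> \<Longrightarrow> C \<in> Obj \<A> \<Longrightarrow> Src \<A> (\<^bold>b\<^sup>\<leftarrow> A B C) = (A \<odot> B) \<odot> C"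
  "A \<in> Obj \<A> \<Longrightarrow> B \<in> Obj \<A> \<Longrightarrow> C \<in> Obj \<A> \<Longrightarrow> Trg \<A> (\<^bold>b\<^sup>\<leftarrow> A B C) = A \<odot> (B \<odot> C)"
  using sigma_hom sigma_inv_hom delta_hom delta_inv_hom assoc_right_hom assoc_left_hom
  by (auto simp: hom_iff)

text \<open>Naturality passes to inverses: one inverse pair of associators is inserted on the left,
  \<open>assoc_nat\<close> is applied, and another pair cancels on the right.\<close>

lemma (in monoidal_category) assoc_left_nat:
  assumes f: "f \<in> hom \<A> A D" and g: "g \<in> hom \<A> B E" and h: "h \<in> hom \<A> C F"
  shows "(f \<otimes> (g \<otimes> h)) \<cdot> \<^bold>b\<^sup>\<leftarrow> A B C = \<^bold>b\<^sup>\<leftarrow> D E F \<cdot> ((f \<otimes> g) \<otimes> h)"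
proof -
  note [simp] = f[unfolded hom_iff] g[unfolded hom_iff] h[unfolded hom_iff]
  have Obj [simp]: "A \<in> Obj \<A>" "B \<in> Obj \<A>" "C \<in> Obj \<A>" "D \<in> Obj \<A>" "E \<in> Obj \<A>" "F \<in> Obj \<A>"
    using f g h by (blast dest: hom_Obj)+
  have "(f \<otimes> (g \<otimes> h)) \<cdot> \<^bold>b\<^sup>\<leftarrow> A B C
      = (\<^bold>b\<^sup>\<leftarrow> D E F \<cdot> \<^bold>b\<^sup>\<rightarrow> D E F) \<cdot> ((f \<otimes> (g \<otimes> h)) \<cdot> \<^bold>b\<^sup>\<leftarrow> A B C)"
    by (simp add: assoc_left_right)
  also have "\<dots> = \<^bold>b\<^sup>\<leftarrow> D E F \<cdot> ((\<^bold>b\<^sup>\<rightarrow> D E F \<cdot> (f \<otimes> (g \<otimes> h))) \<cdot> \<^bold>b\<^sup>\<leftarrow> A B C)"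
    by (simp add: cmp_assoc_Arr)
  also have "\<dots> = \<^bold>b\<^sup>\<leftarrow> D E F \<cdot> (((f \<otimes> g) \<otimes> h) \<cdot> (\<^bold>b\<^sup>\<rightarrow> A B C \<cdot> \<^bold>b\<^sup>\<leftarrow> A B C))"
    by (simp add: assoc_nat[OF f g h, symmetric] cmp_assoc_Arr)
  finally show ?thesis
    by (simp add: assoc_right_left)
qed

section \<open>The symmetry and the middle interchange\<close>

context symmetric_monoidal_category
begin

lemma Src_Trg_symm [simp]:
  "A \<in> Obj \<A> \<Longrightarrow> B \<in> Obj \<A> \<Longrightarrow> \<^bold>c A B \<in> Arr \<A>"
  "A \<in> Obj \<A> \<Longrightarrow> B \<in> Obj \<A> \<Longrightarrow> Src \<A> (\<^bold>c A B) = A \<odot> B"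
  "A \<in> Obj \<A> \<Longrightarrow> B \<in> Obj \<A> \<Longrightarrow> Trg \<A> (\<^bold>c A B) = B \<odot> A"
  using symm_hom by (auto simp: hom_iff)

lemma Src_Trg_middle_symm [simp]:
  assumes "A \<in> Obj \<A>" "B \<in> Obj \<A>" "C \<in> Obj \<A>" "D \<in> Obj \<A>"
  shows "\<^bold>c\<^sup>m A B C D \<in> Arr \<A>" "Src \<A> (\<^bold>c\<^sup>m A B C D) = (A \<odot> B) \<odot> (C \<odot> D)"
    "Trg \<A> (\<^bold>c\<^sup>m A B C D) = (A \<odot> C) \<odot> (B \<odot> D)"
  using assms by (simp_all add: middle_symm_def)

lemma delta_symm: "A \<in> Obj \<A> \<Longrightarrow> \<^bold>\<delta> A \<cdot> \<^bold>c \<I> A = \<^bold>\<sigma> A"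
  by (simp add: sigma_symm[symmetric] cmp_assoc_Arr symm_symm)

text \<open>At the unit object \<sigma> and \<delta> coincide, so \<sigma> absorbs the symmetry by
  \<open>delta_symm\<close>; being invertible, it can be cancelled.\<close>

lemma symm_unit: "\<^bold>c \<I> \<I> = \<one> (\<I> \<odot> \<I>)"
proof -
  have "\<^bold>c \<I> \<I> = (\<^bold>\<sigma>i \<I> \<cdot> \<^bold>\<sigma> \<I>) \<cdot> \<^bold>c \<I> \<I>"
    by (simp add: sigma_inv_sigma)
  also have "\<dots> = \<^bold>\<sigma>i \<I> \<cdot> \<^bold>\<sigma> \<I>"
    by (simp add: cmp_assoc_Arr delta_symm sigma_unit)
  finally show ?thesis
    by (simp add: sigma_inv_sigma)
qed

text \<open>With both middle objects the unit, the swap inside \<open>middle_symm\<close> is an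
  identity by \<open>symm_unit\<close>, and the associators around it cancel in pairs.\<close>

lemma middle_symm_unit:
  "A \<in> Obj \<A> \<Longrightarrow> B \<in> Obj \<A> \<Longrightarrow> \<^bold>c\<^sup>m A \<I> \<I> B = \<one> ((A \<odot> \<I>) \<odot> (\<I> \<odot> B))"
  by (simp add: middle_symm_def symm_unit assoc_left_right assoc_right_left cmp_assoc_Arr)

lemma middle_symm_nat:
  assumes f: "f \<in> hom \<A> A A'" and g: "g \<in> hom \<A> B B'"
    and h: "h \<in> hom \<A> C C'" and l: "l \<in> hom \<A> D D'"
  shows "((f \<otimes> h) \<otimes> (g \<otimes> l)) \<cdot> \<^bold>c\<^sup>m A B C D = \<^bold>c\<^sup>m A' B' C' D' \<cdot> ((f \<otimes> g) \<otimes> (h \<otimes> l))"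
proof -
  note [simp] = f[unfolded hom_iff] g[unfolded hom_iff] h[unfolded hom_iff] l[unfolded hom_iff]
  have Obj [simp]: "A \<in> Obj \<A>" "B \<in> Obj \<A>" "C \<in> Obj \<A>" "D \<in> Obj \<A>"
    "A' \<in> Obj \<A>" "B' \<in> Obj \<A>" "C' \<in> Obj \<A>" "D' \<in> Obj \<A>"
    using f g h l by (blast dest: hom_Obj)+
  \<comment> \<open>\<open>m\<close> and \<open>m'\<close> are the inner blocks of the two
    interchanges, swapping the first two of three factors. Their naturality square is settled first
    and then carried through the outer associators.\<close>
  define m where "m = \<^bold>b\<^sup>\<leftarrow> C B D \<cdot> (\<^bold>c B C \<otimes> \<one> D) \<cdot> \<^bold>b\<^sup>\<rightarrow> B C D"
  define m' where "m' = \<^bold>b\<^sup>\<leftarrow> C' B' D' \<cdot> (\<^bold>c B' C' \<otimes> \<one> D') \<cdot> \<^bold>b\<^sup>\<rightarrow> B' C' D'"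
  have [simp]: "m \<in> Arr \<A>" "Src \<A> m = B \<odot> (C \<odot> D)" "Trg \<A> m = C \<odot> (B \<odot> D)"
    "m' \<in> Arr \<A>" "Src \<A> m' = B' \<odot> (C' \<odot> D')" "Trg \<A> m' = C' \<odot> (B' \<odot> D')"
    by (simp_all add: m_def m'_def)
  have "(h \<otimes> (g \<otimes> l)) \<cdot> m = ((h \<otimes> (g \<otimes> l)) \<cdot> \<^bold>b\<^sup>\<leftarrow> C B D) \<cdot> ((\<^bold>c B C \<otimes> \<one> D) \<cdot> \<^bold>b\<^sup>\<rightarrow> B C D)"
    by (simp add: m_def cmp_assoc_Arr)
  also have "\<dots> = \<^bold>b\<^sup>\<leftarrow> C' B' D' \<cdot> ((((h \<otimes> g) \<otimes> l) \<cdot> (\<^bold>c B C \<otimes> \<one> D)) \<cdot> \<^bold>b\<^sup>\<rightarrow> B C D)"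
    by (simp add: assoc_left_nat[OF h g l] cmp_assoc_Arr)
  also have "((h \<otimes> g) \<otimes> l) \<cdot> (\<^bold>c B C \<otimes> \<one> D) = (\<^bold>c B' C' \<otimes> \<one> D') \<cdot> ((g \<otimes> h) \<otimes> l)"
    by (simp add: mult_cmp_Arr symm_nat[OF g h])
  also have "\<^bold>b\<^sup>\<leftarrow> C' B' D' \<cdot> (((\<^bold>c B' C' \<otimes> \<one> D') \<cdot> ((g \<otimes> h) \<otimes> l)) \<cdot> \<^bold>b\<^sup>\<rightarrow> B C D) = m' \<cdot> (g \<otimes> (h \<otimes> l))"
    by (simp add: m'_def cmp_assoc_Arr assoc_nat[OF g h l])
  finally have m: "(h \<otimes> (g \<otimes> l)) \<cdot> m = m' \<cdot> (g \<otimes> (h \<otimes> l))" .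
  have gl: "g \<otimes> l \<in> hom \<A> (B \<odot> D) (B' \<odot> D')" and hl: "h \<otimes> l \<in> hom \<A> (C \<odot> D) (C' \<odot> D')"
    by (simp_all add: hom_iff)
  have "((f \<otimes> h) \<otimes> (g \<otimes> l)) \<cdot> \<^bold>c\<^sup>m A B C D
      = (((f \<otimes> h) \<otimes> (g \<otimes> l)) \<cdot> \<^bold>b\<^sup>\<rightarrow> A C (B \<odot> D)) \<cdot> ((\<one> A \<otimes> m) \<cdot> \<^bold>b\<^sup>\<leftarrow> A B (C \<odot> D))"
    by (simp add: middle_symm_def m_def[symmetric] cmp_assoc_Arr)
  also have "\<dots> = \<^bold>b\<^sup>\<rightarrow> A' C' (B' \<odot> D') \<cdot> (((f \<otimes> (h \<otimes> (g \<otimes> l))) \<cdot> (\<one> A \<otimes> m)) \<cdot> \<^bold>b\<^sup>\<leftarrow> A B (C \<odot> D))"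
    by (simp add: assoc_nat[OF f h gl] cmp_assoc_Arr)
  also have "(f \<otimes> (h \<otimes> (g \<otimes> l))) \<cdot> (\<one> A \<otimes> m) = (\<one> A' \<otimes> m') \<cdot> (f \<otimes> (g \<otimes> (h \<otimes> l)))"
    by (simp add: mult_cmp_Arr m)
  also have "\<^bold>b\<^sup>\<rightarrow> A' C' (B' \<odot> D') \<cdot> (((\<one> A' \<otimes> m') \<cdot> (f \<otimes> (g \<otimes> (h \<otimes> l)))) \<cdot> \<^bold>b\<^sup>\<leftarrow> A B (C \<odot> D))
      = \<^bold>c\<^sup>m A' B' C' D' \<cdot> ((f \<otimes> g) \<otimes> (h \<otimes> l))"
    by (simp add: middle_symm_def m'_def[symmetric] cmp_assoc_Arr assoc_left_nat[OF f g hl])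
  finally show ?thesis .
qed

text \<open>Inverse pairs meet at the centre: outer associators, then those of the inner blocks,
  then the symmetries, after which the remaining associators cancel too. This serves to solve the
  axiom \<open>middle_symm_w\<close> for \<open>w (A \<odot> B)\<close>.\<close>

lemma middle_symm_middle_symm:
  assumes [simp]: "A \<in> Obj \<A>" "B \<in> Obj \<A>" "C \<in> Obj \<A>" "D \<in> Obj \<A>"
  shows "\<^bold>c\<^sup>m A C B D \<cdot> \<^bold>c\<^sup>m A B C D = \<one> ((A \<odot> B) \<odot> (C \<odot> D))"
proof -
  \<comment> \<open>A function of \<open>B\<close> and \<open>C\<close>, because the second
    interchange contains the block with these two exchanged.\<close>
  define m where "m B C = \<^bold>b\<^sup>\<leftarrow> C B D \<cdot> (\<^bold>c B C \<otimes> \<one> D) \<cdot> \<^bold>b\<^sup>\<rightarrow> B C D" for B C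
  have [simp]: "m B C \<in> Arr \<A>" "Src \<A> (m B C) = B \<odot> (C \<odot> D)" "Trg \<A> (m B C) = C \<odot> (B \<odot> D)"
    if "B \<in> Obj \<A>" "C \<in> Obj \<A>" for B C
    using that by (simp_all add: m_def)
  have "m C B \<cdot> m B C
      = \<^bold>b\<^sup>\<leftarrow> B C D \<cdot> ((\<^bold>c C B \<otimes> \<one> D) \<cdot> ((\<^bold>b\<^sup>\<rightarrow> C B D \<cdot> \<^bold>b\<^sup>\<leftarrow> C B D) \<cdot> ((\<^bold>c B C \<otimes> \<one> D) \<cdot> \<^bold>b\<^sup>\<rightarrow> B C D)))"
    by (simp add: m_def cmp_assoc_Arr)
  also have "\<dots> = \<^bold>b\<^sup>\<leftarrow> B C D \<cdot> (((\<^bold>c C B \<otimes> \<one> D) \<cdot> (\<^bold>c B C \<otimes> \<one> D)) \<cdot> \<^bold>b\<^sup>\<rightarrow> B C D)"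
    by (simp add: assoc_right_left cmp_assoc_Arr)
  also have "\<dots> = \<one> (B \<odot> (C \<odot> D))"
    by (simp add: mult_cmp_Arr symm_symm assoc_left_right)
  finally have m: "m C B \<cdot> m B C = \<one> (B \<odot> (C \<odot> D))" .
  have "\<^bold>c\<^sup>m A C B D \<cdot> \<^bold>c\<^sup>m A B C D
      = \<^bold>b\<^sup>\<rightarrow> A B (C \<odot> D) \<cdot> ((\<one> A \<otimes> m C B) \<cdot> ((\<^bold>b\<^sup>\<leftarrow> A C (B \<odot> D) \<cdot> \<^bold>b\<^sup>\<rightarrow> A C (B \<odot> D))
          \<cdot> ((\<one> A \<otimes> m B C) \<cdot> \<^bold>b\<^sup>\<leftarrow> A B (C \<odot> D))))"
    by (simp add: middle_symm_def m_def[symmetric] cmp_assoc_Arr)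
  also have "\<dots> = \<^bold>b\<^sup>\<rightarrow> A B (C \<odot> D) \<cdot> (((\<one> A \<otimes> m C B) \<cdot> (\<one> A \<otimes> m B C)) \<cdot> \<^bold>b\<^sup>\<leftarrow> A B (C \<odot> D))"
    by (simp add: assoc_left_right cmp_assoc_Arr)
  also have "\<dots> = \<one> ((A \<odot> B) \<odot> (C \<odot> D))"
    by (simp add: mult_cmp_Arr m assoc_right_left)
  finally show ?thesis .
qed

end

section \<open>The projections of a binary product\<close>

context cartesian_category
begin

lemma Src_Trg_w_k [simp]:
  "A \<in> Obj \<A> \<Longrightarrow> w A \<in> Arr \<A>" "A \<in> Obj \<A> \<Longrightarrow> Src \<A> (w A) = A" "A \<in> Obj \<A> \<Longrightarrow> Trg \<A> (w A) = A \<odot> A"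
  "A \<in> Obj \<A> \<Longrightarrow> k A \<in> Arr \<A>" "A \<in> Obj \<A> \<Longrightarrow> Src \<A> (k A) = A" "A \<in> Obj \<A> \<Longrightarrow> Trg \<A> (k A) = \<I>"
  using w_hom k_hom by (auto simp: hom_iff)

lemma k_cmp: "f \<in> Arr \<A> \<Longrightarrow> Trg \<A> f = B \<Longrightarrow> k B \<cdot> f = k (Src \<A> f)"
  using k_nat[of f] by (simp add: hom_iff)

text \<open>This makes the unit object terminal: naturality of \<open>k\<close> gives
  \<open>k \<I> \<cdot> f = k (Src \<A> f)\<close>, and the first factor is an identity.\<close>

lemma to_unit_unique: "f \<in> Arr \<A> \<Longrightarrow> Trg \<A> f = \<I> \<Longrightarrow> f = k (Src \<A> f)"
  using k_cmp[of f \<I>] by (simp add: k_unit)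

definition fst_arr :: "'o \<Rightarrow> 'o \<Rightarrow> 'a" where
  "fst_arr A B = \<^bold>\<delta> A \<cdot> (\<one> A \<otimes> k B)"

definition snd_arr :: "'o \<Rightarrow> 'o \<Rightarrow> 'a" where
  "snd_arr A B = \<^bold>\<sigma> B \<cdot> (k A \<otimes> \<one> B)"

lemma Src_Trg_fst_snd [simp]:
  assumes "A \<in> Obj \<A>" "B \<in> Obj \<A>"
  shows "fst_arr A B \<in> Arr \<A>" "Src \<A> (fst_arr A B) = A \<odot> B" "Trg \<A> (fst_arr A B) = A"
    "snd_arr A B \<in> Arr \<A>" "Src \<A> (snd_arr A B) = A \<odot> B" "Trg \<A> (snd_arr A B) = B"
  using assms by (simp_all add: fst_arr_def snd_arr_def)

text \<open>\<open>k\<close> absorbs \<open>g\<close>, since the second factor is discarded anyway;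
  naturality of \<delta> then moves \<open>f\<close> outside.\<close>

lemma fst_nat:
  assumes f: "f \<in> hom \<A> A C" and g: "g \<in> hom \<A> B D"
  shows "fst_arr C D \<cdot> (f \<otimes> g) = f \<cdot> fst_arr A B"
proof -
  note [simp] = f[unfolded hom_iff] g[unfolded hom_iff]
  have Obj [simp]: "A \<in> Obj \<A>" "B \<in> Obj \<A>" "C \<in> Obj \<A>" "D \<in> Obj \<A>"
    using f g by (blast dest: hom_Obj)+
  have "fst_arr C D \<cdot> (f \<otimes> g) = \<^bold>\<delta> C \<cdot> ((f \<otimes> \<one> \<I>) \<cdot> (\<one> A \<otimes> k B))"
    by (simp add: fst_arr_def cmp_assoc_Arr mult_cmp_Arr k_cmp)
  also have "\<dots> = f \<cdot> fst_arr A B"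
    using delta_nat[OF f, symmetric] by (simp add: fst_arr_def cmp_assoc_Arr[symmetric])
  finally show ?thesis .
qed

lemma snd_nat:
  assumes f: "f \<in> hom \<A> A C" and g: "g \<in> hom \<A> B D"
  shows "snd_arr C D \<cdot> (f \<otimes> g) = g \<cdot> snd_arr A B"
proof -
  note [simp] = f[unfolded hom_iff] g[unfolded hom_iff]
  have Obj [simp]: "A \<in> Obj \<A>" "B \<in> Obj \<A>" "C \<in> Obj \<A>" "D \<in> Obj \<A>"
    using f g by (blast dest: hom_Obj)+
  have "snd_arr C D \<cdot> (f \<otimes> g) = \<^bold>\<sigma> D \<cdot> ((\<one> \<I> \<otimes> g) \<cdot> (k A \<otimes> \<one> B))"
    by (simp add: snd_arr_def cmp_assoc_Arr mult_cmp_Arr k_cmp)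
  also have "\<dots> = g \<cdot> snd_arr A B"
    using sigma_nat[OF g, symmetric] by (simp add: snd_arr_def cmp_assoc_Arr[symmetric])
  finally show ?thesis .
qed

text \<open>Naturality against \<open>k A\<close> moves the symmetry to the pair of
  \<open>\<I>\<close> and \<open>B\<close>, where \<open>delta_symm\<close> turns \<delta> into
  \<sigma>.\<close>

lemma fst_symm:
  assumes [simp]: "A \<in> Obj \<A>" "B \<in> Obj \<A>"
  shows "fst_arr B A \<cdot> \<^bold>c A B = snd_arr A B"
proof -
  have "(\<one> B \<otimes> k A) \<cdot> \<^bold>c A B = \<^bold>c \<I> B \<cdot> (k A \<otimes> \<one> B)"
    by (rule symm_nat) (simp_all add: hom_iff)
  then have "fst_arr B A \<cdot> \<^bold>c A B = (\<^bold>\<delta> B \<cdot> \<^bold>c \<I> B) \<cdot> (k A \<otimes> \<one> B)"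
    by (simp add: fst_arr_def cmp_assoc_Arr)
  then show ?thesis
    by (simp add: delta_symm snd_arr_def)
qed

lemma snd_symm:
  assumes [simp]: "A \<in> Obj \<A>" "B \<in> Obj \<A>"
  shows "snd_arr B A \<cdot> \<^bold>c A B = fst_arr A B"
proof -
  have "snd_arr B A \<cdot> \<^bold>c A B = fst_arr A B \<cdot> (\<^bold>c B A \<cdot> \<^bold>c A B)"
    by (simp add: fst_symm[symmetric] cmp_assoc_Arr)
  then show ?thesis
    by (simp add: symm_symm)
qed

lemma fst_w: "A \<in> Obj \<A> \<Longrightarrow> fst_arr A A \<cdot> w A = \<one> A"
  and snd_w: "A \<in> Obj \<A> \<Longrightarrow> snd_arr A A \<cdot> w A = \<one> A"
  by (simp_all add: fst_arr_def snd_arr_def delta_k_w sigma_k_w)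

lemma fst_delta: "A \<in> Obj \<A> \<Longrightarrow> fst_arr A \<I> = \<^bold>\<delta> A"
  and snd_sigma: "A \<in> Obj \<A> \<Longrightarrow> snd_arr \<I> A = \<^bold>\<sigma> A"
  by (simp_all add: fst_arr_def snd_arr_def k_unit)

text \<open>The triangle axiom extended to an arbitrary middle object: \<open>k B\<close> carries
  \<open>B\<close> to the unit, and by naturality of the associator this may happen before or after
  rebracketing.\<close>

lemma triangle_k:
  assumes [simp]: "A \<in> Obj \<A>" "B \<in> Obj \<A>" "C \<in> Obj \<A>"
  shows "(fst_arr A B \<otimes> \<one> C) \<cdot> \<^bold>b\<^sup>\<rightarrow> A B C = \<one> A \<otimes> snd_arr B C"
proof -
  have "((\<one> A \<otimes> k B) \<otimes> \<one> C) \<cdot> \<^bold>b\<^sup>\<rightarrow> A B C = \<^bold>b\<^sup>\<rightarrow> A \<I> C \<cdot> (\<one> A \<otimes> (k B \<otimes> \<one> C))"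
    by (rule assoc_nat) (simp_all add: hom_iff)
  moreover have "fst_arr A B \<otimes> \<one> C = (\<^bold>\<delta> A \<otimes> \<one> C) \<cdot> ((\<one> A \<otimes> k B) \<otimes> \<one> C)"
    by (simp add: fst_arr_def mult_cmp_Arr)
  ultimately have "(fst_arr A B \<otimes> \<one> C) \<cdot> \<^bold>b\<^sup>\<rightarrow> A B C
      = ((\<^bold>\<delta> A \<otimes> \<one> C) \<cdot> \<^bold>b\<^sup>\<rightarrow> A \<I> C) \<cdot> (\<one> A \<otimes> (k B \<otimes> \<one> C))"
    by (simp add: cmp_assoc_Arr)
  also have "\<dots> = \<one> A \<otimes> snd_arr B C"
    by (simp add: triangle mult_cmp_Arr snd_arr_def)
  finally show ?thesis .
qed

text \<open>By \<open>fst_nat\<close> the two nested projections become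
  \<open>fst_arr A B \<otimes> \<one> C\<close> followed by \<open>fst_arr A C\<close>, so that
  \<open>triangle_k\<close> applies.\<close>

lemma fst_fst_assoc:
  assumes [simp]: "A \<in> Obj \<A>" "B \<in> Obj \<A>" "C \<in> Obj \<A>"
  shows "fst_arr A B \<cdot> (fst_arr (A \<odot> B) C \<cdot> \<^bold>b\<^sup>\<rightarrow> A B C) = fst_arr A (B \<odot> C)"
proof -
  have "fst_arr A C \<cdot> (fst_arr A B \<otimes> \<one> C) = fst_arr A B \<cdot> fst_arr (A \<odot> B) C"
    by (rule fst_nat) (simp_all add: hom_iff)
  then have "fst_arr A B \<cdot> (fst_arr (A \<odot> B) C \<cdot> \<^bold>b\<^sup>\<rightarrow> A B C)
      = fst_arr A C \<cdot> ((fst_arr A B \<otimes> \<one> C) \<cdot> \<^bold>b\<^sup>\<rightarrow> A B C)"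
    by (simp add: cmp_assoc_Arr[symmetric])
  also have "\<dots> = \<one> A \<cdot> fst_arr A (B \<odot> C)"
    unfolding triangle_k[OF assms] by (rule fst_nat) (simp_all add: hom_iff)
  finally show ?thesis
    by simp
qed

text \<open>The same detour through \<open>fst_arr A B \<otimes> \<one> C\<close>: as only
  \<open>C\<close> is kept, discarding \<open>B\<close> beforehand changes nothing, and
  \<open>triangle_k\<close> applies.\<close>

lemma snd_assoc:
  assumes [simp]: "A \<in> Obj \<A>" "B \<in> Obj \<A>" "C \<in> Obj \<A>"
  shows "snd_arr (A \<odot> B) C \<cdot> \<^bold>b\<^sup>\<rightarrow> A B C = snd_arr B C \<cdot> snd_arr A (B \<odot> C)"
proof -
  have "snd_arr A C \<cdot> (fst_arr A B \<otimes> \<one> C) = \<one> C \<cdot> snd_arr (A \<odot> B) C"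
    by (rule snd_nat) (simp_all add: hom_iff)
  then have "snd_arr (A \<odot> B) C \<cdot> \<^bold>b\<^sup>\<rightarrow> A B C = snd_arr A C \<cdot> ((fst_arr A B \<otimes> \<one> C) \<cdot> \<^bold>b\<^sup>\<rightarrow> A B C)"
    by (simp add: cmp_assoc_Arr[symmetric])
  also have "\<dots> = snd_arr B C \<cdot> snd_arr A (B \<odot> C)"
    unfolding triangle_k[OF assms] by (rule snd_nat) (simp_all add: hom_iff)
  finally show ?thesis .
qed

text \<open>The hexagon reduces the middle projection to \<open>snd_assoc\<close>, avoiding Kelly's unit lemmas.\<close>

lemma snd_fst_assoc:
  assumes [simp]: "A \<in> Obj \<A>" "B \<in> Obj \<A>" "C \<in> Obj \<A>"
  shows "snd_arr A B \<cdot> (fst_arr (A \<odot> B) C \<cdot> \<^bold>b\<^sup>\<rightarrow> A B C) = fst_arr B C \<cdot> snd_arr A (B \<odot> C)"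
proof -
  have "snd_arr A B \<cdot> (fst_arr (A \<odot> B) C \<cdot> \<^bold>b\<^sup>\<rightarrow> A B C)
      = (snd_arr A B \<cdot> snd_arr C (A \<odot> B)) \<cdot> (\<^bold>c (A \<odot> B) C \<cdot> \<^bold>b\<^sup>\<rightarrow> A B C)"
    by (simp add: snd_symm[symmetric] cmp_assoc_Arr)
  \<comment> \<open>\<open>snd_assoc\<close> for \<open>C\<close>, \<open>A\<close>,
    \<open>B\<close> read backwards supplies the associator that completes the left side of the
    hexagon.\<close>
  also have "\<dots> = snd_arr (C \<odot> A) B \<cdot> (\<^bold>b\<^sup>\<rightarrow> C A B \<cdot> \<^bold>c (A \<odot> B) C \<cdot> \<^bold>b\<^sup>\<rightarrow> A B C)"
    by (simp add: snd_assoc[symmetric] cmp_assoc_Arr)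
  also have "\<dots> = (snd_arr (C \<odot> A) B \<cdot> (\<^bold>c A C \<otimes> \<one> B)) \<cdot> (\<^bold>b\<^sup>\<rightarrow> A C B \<cdot> (\<one> A \<otimes> \<^bold>c B C))"
    unfolding hexagon[OF assms] by (simp add: cmp_assoc_Arr)
  also have "snd_arr (C \<odot> A) B \<cdot> (\<^bold>c A C \<otimes> \<one> B) = \<one> B \<cdot> snd_arr (A \<odot> C) B"
    by (rule snd_nat) (simp_all add: hom_iff)
  also have "(\<one> B \<cdot> snd_arr (A \<odot> C) B) \<cdot> (\<^bold>b\<^sup>\<rightarrow> A C B \<cdot> (\<one> A \<otimes> \<^bold>c B C))
      = snd_arr C B \<cdot> (snd_arr A (C \<odot> B) \<cdot> (\<one> A \<otimes> \<^bold>c B C))"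
    using snd_assoc[of A C B] by (simp add: cmp_assoc_Arr[symmetric])
  also have "snd_arr A (C \<odot> B) \<cdot> (\<one> A \<otimes> \<^bold>c B C) = \<^bold>c B C \<cdot> snd_arr A (B \<odot> C)"
    by (rule snd_nat) (simp_all add: hom_iff)
  also have "snd_arr C B \<cdot> (\<^bold>c B C \<cdot> snd_arr A (B \<odot> C)) = fst_arr B C \<cdot> snd_arr A (B \<odot> C)"
    by (simp add: cmp_assoc_Arr[symmetric] snd_symm)
  finally show ?thesis .
qed

section \<open>Surjective pairing and joint monicity of the projections\<close>

lemma fst_snd_pairing:
  assumes [simp]: "A \<in> Obj \<A>" "B \<in> Obj \<A>"
  shows "(fst_arr A B \<otimes> snd_arr A B) \<cdot> w (A \<odot> B) = \<one> (A \<odot> B)"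
proof -
  \<comment> \<open>\<open>middle_symm_w\<close> describes \<open>w (A \<odot> B)\<close> only
    behind an interchange; composing with the inverse interchange isolates it.\<close>
  have "w (A \<odot> B) = (\<^bold>c\<^sup>m A A B B \<cdot> \<^bold>c\<^sup>m A B A B) \<cdot> w (A \<odot> B)"
    by (simp add: middle_symm_middle_symm)
  also have "\<dots> = \<^bold>c\<^sup>m A A B B \<cdot> (w A \<otimes> w B)"
    by (simp add: cmp_assoc_Arr middle_symm_w)
  finally have w: "w (A \<odot> B) = \<^bold>c\<^sup>m A A B B \<cdot> (w A \<otimes> w B)" .
  have "fst_arr A B \<otimes> snd_arr A B = (\<^bold>\<delta> A \<otimes> \<^bold>\<sigma> B) \<cdot> ((\<one> A \<otimes> k B) \<otimes> (k A \<otimes> \<one> B))"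
    by (simp add: fst_arr_def snd_arr_def mult_cmp_Arr)
  then have "(fst_arr A B \<otimes> snd_arr A B) \<cdot> w (A \<odot> B)
      = (\<^bold>\<delta> A \<otimes> \<^bold>\<sigma> B) \<cdot> ((((\<one> A \<otimes> k B) \<otimes> (k A \<otimes> \<one> B)) \<cdot> \<^bold>c\<^sup>m A A B B) \<cdot> (w A \<otimes> w B))"
    by (simp add: w cmp_assoc_Arr)
  \<comment> \<open>Past the arrows \<open>k\<close>, the two objects that change places are both
    the unit, so the interchange disappears by \<open>middle_symm_unit\<close> in the next
    step.\<close>
  also have "((\<one> A \<otimes> k B) \<otimes> (k A \<otimes> \<one> B)) \<cdot> \<^bold>c\<^sup>m A A B B
      = \<^bold>c\<^sup>m A \<I> \<I> B \<cdot> ((\<one> A \<otimes> k A) \<otimes> (k B \<otimes> \<one> B))"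
    by (rule middle_symm_nat) (simp_all add: hom_iff)
  also have "(\<^bold>\<delta> A \<otimes> \<^bold>\<sigma> B) \<cdot> ((\<^bold>c\<^sup>m A \<I> \<I> B \<cdot> ((\<one> A \<otimes> k A) \<otimes> (k B \<otimes> \<one> B))) \<cdot> (w A \<otimes> w B))
      = (fst_arr A A \<cdot> w A) \<otimes> (snd_arr B B \<cdot> w B)"
    by (simp add: middle_symm_unit mult_cmp_Arr fst_arr_def snd_arr_def cmp_assoc_Arr)
  finally show ?thesis
    by (simp add: fst_w snd_w)
qed

text \<open>By surjective pairing and naturality of \<open>w\<close>, an arrow into the product is a
  fixed expression in its composites with the two projections.\<close>

lemma fst_snd_jointly_monic:
  assumes f: "f \<in> hom \<A> C (A \<odot> B)" and g: "g \<in> hom \<A> C (A \<odot> B)"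
    and Obj [simp]: "A \<in> Obj \<A>" "B \<in> Obj \<A>"
    and eq: "fst_arr A B \<cdot> f = fst_arr A B \<cdot> g" "snd_arr A B \<cdot> f = snd_arr A B \<cdot> g"
  shows "f = g"
proof -
  have "h = ((fst_arr A B \<cdot> h) \<otimes> (snd_arr A B \<cdot> h)) \<cdot> w C" if h: "h \<in> hom \<A> C (A \<odot> B)" for h
  proof -
    note [simp] = h[unfolded hom_iff]
    have [simp]: "C \<in> Obj \<A>"
      using h by (rule hom_Obj)
    have "h = (fst_arr A B \<otimes> snd_arr A B) \<cdot> (w (A \<odot> B) \<cdot> h)"
      by (simp add: cmp_assoc_Arr[symmetric] fst_snd_pairing)
    also have "\<dots> = ((fst_arr A B \<otimes> snd_arr A B) \<cdot> (h \<otimes> h)) \<cdot> w C"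
      by (simp add: w_nat[OF h, symmetric] cmp_assoc_Arr)
    finally show ?thesis
      by (simp add: mult_cmp_Arr)
  qed
  from this[OF f] this[OF g] eq show ?thesis
    by simp
qed

section \<open>Projections to the boxes of a shape\<close>

primrec box_proj :: "shape \<Rightarrow> nat \<Rightarrow> 'o list \<Rightarrow> 'a" where
  "box_proj Box i As = \<one> (hd As)"
| "box_proj Unit i As = \<one> \<I>"
| "box_proj (F \<diamondop> G) i As =
    (let A = shape_obj \<A> F (take (arity F) As); B = shape_obj \<A> G (drop (arity F) As)
     in if i < arity F then box_proj F i (take (arity F) As) \<cdot> fst_arr A B
        else box_proj G (i - arity F) (drop (arity F) As) \<cdot> snd_arr A B)"

text \<open>The bound on \<open>i\<close> secures the target: an index in range never reaches the
  \<open>Unit\<close> clause of \<open>box_proj\<close>, whose value is a default.\<close>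

lemma box_proj_hom:
  "As \<in> tuples \<A> (arity F) \<Longrightarrow> i < arity F \<Longrightarrow> box_proj F i As \<in> hom \<A> (shape_obj \<A> F As) (As ! i)"
proof (induction F arbitrary: i As)
  case Box
  then show ?case
    by (cases As) (auto simp: hom_iff tuples_def)
next
  case (Mult F G)
  have As: "take (arity F) As \<in> tuples \<A> (arity F)" "drop (arity F) As \<in> tuples \<A> (arity G)"
    using Mult.prems(1) by (auto dest: tuples_take_drop)
  have len: "length As = arity F + arity G"
    using Mult.prems(1) by (simp add: tuples_def)
  note [simp] = As[THEN shape_obj_Obj]
  show ?case
    using Mult.IH(1)[OF As(1), of i] Mult.IH(2)[OF As(2), of "i - arity F"] Mult.prems(2) len
    by (auto simp: Let_def hom_iff)
qed simp

text \<open>For a product, the induction hypotheses give equality of both components and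
  \<open>fst_snd_jointly_monic\<close> joins them. For \<open>Unit\<close> the family of projections
  is empty, and the claim is that the unit object is terminal.\<close>

lemma box_proj_jointly_monic:
  "As \<in> tuples \<A> (arity F) \<Longrightarrow> f \<in> hom \<A> C (shape_obj \<A> F As) \<Longrightarrow> g \<in> hom \<A> C (shape_obj \<A> F As)
    \<Longrightarrow> (\<And>i. i < arity F \<Longrightarrow> box_proj F i As \<cdot> f = box_proj F i As \<cdot> g) \<Longrightarrow> f = g"
proof (induction F arbitrary: As f g)
  case Box
  then show ?case
    by (cases As) (auto simp: hom_iff tuples_def)
next
  case Unit
  then show ?case
    using to_unit_unique[of f] to_unit_unique[of g] by (simp add: hom_iff)
next
  case (Mult F G)
  have As: "take (arity F) As \<in> tuples \<A> (arity F)" "drop (arity F) As \<in> tuples \<A> (arity G)"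
    using Mult.prems(1) by (auto dest: tuples_take_drop)
  note [simp] = As[THEN shape_obj_Obj]
  let ?A = "shape_obj \<A> F (take (arity F) As)" and ?B = "shape_obj \<A> G (drop (arity F) As)"
  note fg [simp] = Mult.prems(2,3)[unfolded hom_iff]
  have "fst_arr ?A ?B \<cdot> f = fst_arr ?A ?B \<cdot> g"
  proof (rule Mult.IH(1)[OF As(1)])
    fix i assume i: "i < arity F"
    show "box_proj F i (take (arity F) As) \<cdot> (fst_arr ?A ?B \<cdot> f)
        = box_proj F i (take (arity F) As) \<cdot> (fst_arr ?A ?B \<cdot> g)"
      using Mult.prems(4)[of i] i box_proj_hom[OF As(1) i]
      by (simp add: Let_def cmp_assoc_Arr hom_iff)
  qed (simp_all add: hom_iff)
  moreover have "snd_arr ?A ?B \<cdot> f = snd_arr ?A ?B \<cdot> g"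
  proof (rule Mult.IH(2)[OF As(2)])
    fix i assume i: "i < arity G"
    show "box_proj G i (drop (arity F) As) \<cdot> (snd_arr ?A ?B \<cdot> f)
        = box_proj G i (drop (arity F) As) \<cdot> (snd_arr ?A ?B \<cdot> g)"
      \<comment> \<open>Box \<open>i\<close> of \<open>G\<close> is box \<open>arity F + i\<close>
        of the whole shape.\<close>
      using Mult.prems(4)[of "arity F + i"] i box_proj_hom[OF As(2) i]
      by (simp add: Let_def cmp_assoc_Arr hom_iff)
  qed (simp_all add: hom_iff)
  ultimately show ?case
    using Mult.prems(2,3) by (auto intro: fst_snd_jointly_monic)
qed

section \<open>Canonical transformations followed by box projections\<close>

lemma tuples_addE:
  assumes "As \<in> tuples \<A> (m + n)"
  obtains Xs Ys where "As = Xs @ Ys" "Xs \<in> tuples \<A> m" "Ys \<in> tuples \<A> n"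
  using tuples_take_drop[OF assms] by (metis append_take_drop_id)

lemma reindex_upt: "length As = n \<Longrightarrow> reindex As [0..<n] = As"
  by (auto simp: reindex_def map_nth)

text \<open>Induction on the construction of the transformation. Special arrows reduce to their
  equations with \<open>fst_arr\<close> and \<open>snd_arr\<close>, products to naturality of these,
  and composites to the two hypotheses in succession, which also composes the graphs.\<close>

lemma canonical_box_proj:
  "canonical \<A> w k F G \<Gamma> \<alpha> \<Longrightarrow> As \<in> tuples \<A> (arity F) \<Longrightarrow> i < arity G
    \<Longrightarrow> box_proj G i (reindex As \<Gamma>) \<cdot> \<alpha> As = box_proj F (\<Gamma> ! i) As"
proof (induction arbitrary: As i rule: canonical.induct)
  case (ide F)
  then show ?case
    using box_proj_hom[of As F i] by (simp add: hom_iff reindex_upt tuples_def)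
next
  \<comment> \<open>All boxes of \<open>Unit \<diamondop> F\<close> lie on the right, and the
    projection to that side is \<sigma> by \<open>snd_sigma\<close>. The other three unit cases are
    variants, with an inverse law added where needed.\<close>
  case (sigma F)
  then have As: "As \<in> tuples \<A> (arity F)" "length As = arity F"
    by (simp_all add: tuples_def)
  then show ?case
    using sigma.prems(2) by (simp add: Let_def reindex_upt snd_sigma[OF shape_obj_Obj[OF As(1)]])
next
  case (sigma_inv F)
  then have As: "As \<in> tuples \<A> (arity F)" "length As = arity F"
    by (simp_all add: tuples_def)
  then show ?case
    using sigma_inv.prems(2) box_proj_hom[OF As(1), of i] shape_obj_Obj[OF As(1)]
    by (simp add: Let_def reindex_upt snd_sigma hom_iff cmp_assoc_Arr sigma_sigma_inv)
next
  case (delta F)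
  then have As: "As \<in> tuples \<A> (arity F)" "length As = arity F"
    by (simp_all add: tuples_def)
  then show ?case
    using delta.prems(2) by (simp add: Let_def reindex_upt fst_delta[OF shape_obj_Obj[OF As(1)]])
next
  case (delta_inv F)
  then have As: "As \<in> tuples \<A> (arity F)" "length As = arity F"
    by (simp_all add: tuples_def)
  then show ?case
    using delta_inv.prems(2) box_proj_hom[OF As(1), of i] shape_obj_Obj[OF As(1)]
    by (simp add: Let_def reindex_upt fst_delta hom_iff cmp_assoc_Arr delta_delta_inv)
next
  case (assoc_right F G H)
  then obtain Xs Ys Zs where As: "As = Xs @ Ys @ Zs"
    and t: "Xs \<in> tuples \<A> (arity F)" "Ys \<in> tuples \<A> (arity G)" "Zs \<in> tuples \<A> (arity H)"
    by (auto elim!: tuples_addE)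
  have len [simp]: "length Xs = arity F" "length Ys = arity G" "length Zs = arity H"
    using t by (simp_all add: tuples_def)
  define A B C where ABC: "A = shape_obj \<A> F Xs" "B = shape_obj \<A> G Ys" "C = shape_obj \<A> H Zs"
  have Obj [simp]: "A \<in> Obj \<A>" "B \<in> Obj \<A>" "C \<in> Obj \<A>"
    using t by (simp_all add: ABC shape_obj_Obj)
  \<comment> \<open>The block containing box \<open>i\<close> decides which of
    \<open>fst_fst_assoc\<close>, \<open>snd_fst_assoc\<close> and \<open>snd_assoc\<close>
    applies.\<close>
  consider "i < arity F" | j where "i = arity F + j" "j < arity G"
    | j where "i = arity F + arity G + j" "j < arity H"
    using assoc_right.prems(2)
    by (metis add.assoc add_less_cancel_left arity.simps(3) le_Suc_ex not_less)
  then show ?case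
  proof cases
    case 1
    then show ?thesis
      using box_proj_hom[OF t(1), of i]
      by (simp add: As reindex_upt Let_def ABC[symmetric] hom_iff cmp_assoc_Arr fst_fst_assoc)
  next
    case 2
    then show ?thesis
      using box_proj_hom[OF t(2), of j]
      by (simp add: As reindex_upt Let_def ABC[symmetric] hom_iff cmp_assoc_Arr snd_fst_assoc)
  next
    case 3
    then show ?thesis
      using box_proj_hom[OF t(3), of j]
      by (simp add: As reindex_upt Let_def ABC[symmetric] hom_iff cmp_assoc_Arr snd_assoc)
  qed
next
  case (assoc_left F G H)
  then obtain Xs Ys Zs where As: "As = Xs @ Ys @ Zs"
    and t: "Xs \<in> tuples \<A> (arity F)" "Ys \<in> tuples \<A> (arity G)" "Zs \<in> tuples \<A> (arity H)"
    by (auto elim!: tuples_addE)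
  have len [simp]: "length Xs = arity F" "length Ys = arity G" "length Zs = arity H"
    using t by (simp_all add: tuples_def)
  define A B C where ABC: "A = shape_obj \<A> F Xs" "B = shape_obj \<A> G Ys" "C = shape_obj \<A> H Zs"
  have Obj [simp]: "A \<in> Obj \<A>" "B \<in> Obj \<A>" "C \<in> Obj \<A>"
    using t by (simp_all add: ABC shape_obj_Obj)
  \<comment> \<open>The three equations for the right associator, composed with its inverse.\<close>
  have fst: "fst_arr A (B \<odot> C) \<cdot> \<^bold>b\<^sup>\<leftarrow> A B C = fst_arr A B \<cdot> fst_arr (A \<odot> B) C"
    by (simp add: fst_fst_assoc[symmetric] cmp_assoc_Arr assoc_right_left)
  have mid: "fst_arr B C \<cdot> (snd_arr A (B \<odot> C) \<cdot> \<^bold>b\<^sup>\<leftarrow> A B C) = snd_arr A B \<cdot> fst_arr (A \<odot> B) C"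
    using snd_fst_assoc[of A B C, symmetric]
    by (simp add: cmp_assoc_Arr[symmetric]) (simp add: cmp_assoc_Arr assoc_right_left)
  have snd: "snd_arr B C \<cdot> (snd_arr A (B \<odot> C) \<cdot> \<^bold>b\<^sup>\<leftarrow> A B C) = snd_arr (A \<odot> B) C"
    using snd_assoc[of A B C, symmetric]
    by (simp add: cmp_assoc_Arr[symmetric]) (simp add: cmp_assoc_Arr assoc_right_left)
  consider "i < arity F" | j where "i = arity F + j" "j < arity G"
    | j where "i = arity F + arity G + j" "j < arity H"
    using assoc_left.prems(2)
    by (metis add.assoc add_less_cancel_left arity.simps(3) le_Suc_ex not_less)
  then show ?case
  proof cases
    case 1
    then show ?thesis
      using box_proj_hom[OF t(1), of i]
      by (simp add: As reindex_upt Let_def ABC[symmetric] hom_iff cmp_assoc_Arr fst)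
  next
    case 2
    then show ?thesis
      using box_proj_hom[OF t(2), of j]
      by (simp add: As reindex_upt Let_def ABC[symmetric] hom_iff cmp_assoc_Arr mid)
  next
    case 3
    then show ?thesis
      using box_proj_hom[OF t(3), of j]
      by (simp add: As reindex_upt Let_def ABC[symmetric] hom_iff cmp_assoc_Arr snd)
  qed
next
  case (symm F G)
  then obtain Xs Ys where As: "As = Xs @ Ys"
    and t: "Xs \<in> tuples \<A> (arity F)" "Ys \<in> tuples \<A> (arity G)"
    by (auto elim!: tuples_addE)
  have len [simp]: "length Xs = arity F" "length Ys = arity G"
    using t by (simp_all add: tuples_def)
  note [simp] = t[THEN shape_obj_Obj]
  have re: "reindex As ([arity F..<arity F + arity G] @ [0..<arity F]) = Ys @ Xs"
    by (auto simp: As reindex_def nth_append intro!: nth_equalityI)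
  show ?case
  \<comment> \<open>The boxes of \<open>G\<close> come first in the target and last in the source,
    so the symmetry exchanges the two projections.\<close>
  proof (cases "i < arity G")
    case True
    then show ?thesis
      using box_proj_hom[OF t(2) True] unfolding re
      by (simp add: As Let_def hom_iff cmp_assoc_Arr fst_symm nth_append)
  next
    case False
    then have i: "i - arity G < arity F"
      using symm.prems(2) by auto
    then show ?thesis
      using False box_proj_hom[OF t(1) i] unfolding re
      by (simp add: As Let_def hom_iff cmp_assoc_Arr snd_symm nth_append)
  qed
next
  case (w F)
  then have len: "length As = arity F"
    by (simp add: tuples_def)
  then have re: "reindex As ([0..<arity F] @ [0..<arity F]) = As @ As"
    using reindex_upt[OF len] by (simp add: reindex_def)
  show ?case
    \<comment> \<open>The target carries two copies of the boxes; \<open>i\<close> and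
      \<open>i - arity F\<close> are the positions within the first and the second copy.\<close>
    using w box_proj_hom[OF w.prems(1), of i] box_proj_hom[OF w.prems(1), of "i - arity F"]
      shape_obj_Obj[OF w.prems(1)] len unfolding re
    by (auto simp: Let_def hom_iff cmp_assoc_Arr fst_w snd_w nth_append)
next
  \<comment> \<open>Vacuous, as \<open>Unit\<close> has no boxes; the content of this case sits in
    the \<open>Unit\<close> case of \<open>box_proj_jointly_monic\<close>.\<close>
  case (k F)
  then show ?case
    by simp
next
  case (mult F1 G1 \<Phi> \<alpha> F2 G2 \<Psi> \<beta>)
  then obtain Xs Ys where As: "As = Xs @ Ys"
    and t: "Xs \<in> tuples \<A> (arity F1)" "Ys \<in> tuples \<A> (arity F2)"
    by (auto elim!: tuples_addE)
  note graph = canonical_graph[OF mult.hyps(1)] canonical_graph[OF mult.hyps(2)]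
  have len [simp]: "length Xs = arity F1" "length Ys = arity F2" "length \<Phi> = arity G1"
      "length \<Psi> = arity G2" "length (reindex Xs \<Phi>) = arity G1"
    using t graph by (simp_all add: tuples_def reindex_def)
  have u: "reindex Xs \<Phi> \<in> tuples \<A> (arity G1)" "reindex Ys \<Psi> \<in> tuples \<A> (arity G2)"
    using reindex_tuples[OF t(1), of \<Phi>] reindex_tuples[OF t(2), of \<Psi>] graph by simp_all
  have re: "reindex As (\<Phi> @ map (\<lambda>j. arity F1 + j) \<Psi>) = reindex Xs \<Phi> @ reindex Ys \<Psi>"
    using graph by (auto simp: As reindex_def nth_append)
  note homs = canonical_hom[OF mult.hyps(1) t(1)] canonical_hom[OF mult.hyps(2) t(2)]
  note [simp] = t[THEN shape_obj_Obj] u[THEN shape_obj_Obj] homs[unfolded hom_iff]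
  show ?case
  proof (cases "i < arity G1")
    case True
    then have "\<Phi> ! i < arity F1"
      using graph(1,2) by (metis lessThan_iff nth_mem subsetD)
    \<comment> \<open>The hypothesis is used reversed: after \<open>fst_nat\<close> and
      rebracketing, \<alpha> is grouped with the projection of the source, so the left side of the
      hypothesis no longer occurs as a subterm.\<close>
    then show ?thesis
      using True box_proj_hom[OF u(1) True] mult.IH(1)[OF t(1) True, symmetric] unfolding re
      by (simp add: As Let_def hom_iff cmp_assoc_Arr fst_nat[OF homs] nth_append)
  next
    case False
    then have i: "i - arity G1 < arity G2"
      using mult.prems(2) by auto
    show ?thesis
      using False i box_proj_hom[OF u(2) i] mult.IH(2)[OF t(2) i, symmetric] unfolding re
      by (simp add: As Let_def hom_iff cmp_assoc_Arr snd_nat[OF homs] nth_append)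
  qed
next
  case (cmp F G \<Phi> \<alpha> H \<Psi> \<beta>)
  note graph = canonical_graph[OF cmp.hyps(1)] canonical_graph[OF cmp.hyps(2)]
  have t: "reindex As \<Phi> \<in> tuples \<A> (arity G)"
    using reindex_tuples[OF cmp.prems(1) graph(2)] graph(1) by simp
  have u: "reindex (reindex As \<Phi>) \<Psi> \<in> tuples \<A> (arity H)"
    using reindex_tuples[OF t graph(4)] graph(3) by simp
  \<comment> \<open>Reindexing along the composite graph is reindexing twice, which identifies the
    target with that of \<beta> at \<open>reindex As \<Phi>\<close>.\<close>
  have re: "reindex As (map (\<lambda>i. \<Phi> ! i) \<Psi>) = reindex (reindex As \<Phi>) \<Psi>"
    using graph by (auto simp: reindex_def)
  have i: "\<Psi> ! i < arity G"
    using graph(3,4) cmp.prems(2) by (metis lessThan_iff nth_mem subsetD)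
  have "box_proj H i (reindex (reindex As \<Phi>) \<Psi>) \<cdot> (\<beta> (reindex As \<Phi>) \<cdot> \<alpha> As)
      = (box_proj H i (reindex (reindex As \<Phi>) \<Psi>) \<cdot> \<beta> (reindex As \<Phi>)) \<cdot> \<alpha> As"
    using canonical_hom[OF cmp.hyps(1) cmp.prems(1)] canonical_hom[OF cmp.hyps(2) t]
      box_proj_hom[OF u cmp.prems(2)]
    by (rule cmp_assoc)
  \<comment> \<open>The hypothesis for \<beta> at box \<open>i\<close> leaves box
    \<open>\<Psi> ! i\<close> of \<open>G\<close>, which is the index for the hypothesis on
    \<alpha>.\<close>
  also have "\<dots> = box_proj F (\<Phi> ! (\<Psi> ! i)) As"
    by (simp add: cmp.IH(2)[OF t cmp.prems(2)] cmp.IH(1)[OF cmp.prems(1) i])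
  finally show ?case
    using cmp.prems(2) graph(3) by (simp add: re)
qed

section \<open>Coherence\<close>

lemma canonical_unique:
  assumes \<alpha>: "canonical \<A> w k F G \<Gamma> \<alpha>" and \<beta>: "canonical \<A> w k F G \<Gamma> \<beta>"
    and As: "As \<in> tuples \<A> (arity F)"
  shows "\<alpha> As = \<beta> As"
proof (rule box_proj_jointly_monic)
  \<comment> \<open>The common graph gives both components the same target, so one family of
    projections tests both.\<close>
  show "reindex As \<Gamma> \<in> tuples \<A> (arity G)"
    using reindex_tuples[OF As] canonical_graph[OF \<alpha>] by metis
  show "\<alpha> As \<in> hom \<A> (shape_obj \<A> F As) (shape_obj \<A> G (reindex As \<Gamma>))"
    "\<beta> As \<in> hom \<A> (shape_obj \<A> F As) (shape_obj \<A> G (reindex As \<Gamma>))"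
    using canonical_hom[OF \<alpha> As] canonical_hom[OF \<beta> As] .
qed (simp add: canonical_box_proj[OF \<alpha> As] canonical_box_proj[OF \<beta> As])

end

theorem theorem3:
  fixes \<A> :: "('o, 'a) symmetric_monoidal_category"
    and w k :: "'o \<Rightarrow> 'a"
    and F G :: shape
    and \<Gamma> :: "nat list"
    and \<alpha> \<beta> :: "'o list \<Rightarrow> 'a"
  assumes "cartesian_category \<A> w k"
    and "canonical \<A> w k F G \<Gamma> \<alpha>"
    and "canonical \<A> w k F G \<Gamma> \<beta>"
  shows "\<forall>As \<in> tuples \<A> (arity F). \<alpha> As = \<beta> As"
  using cartesian_category.canonical_unique[OF assms] by blast

end
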